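(* Let $X$ be a metrizable, separable, locally compact space, let $\mathcal F=\{f_1,\dots,f_m\}$ be an iterated function system on $X$ with compact dynamics, and let $N_1,N_2$ be two distinct orbitwise chain nodes of $\mathcal F$. Then the chain node of the Hutchinson map $H_{\mathcal F}$ containing the point $\Omega_{\mathcal F}(N_1)\in\mathcal K(X)$ is different from the chain node of $H_{\mathcal F}$ containing the point $\Omega_{\mathcal F}(N_2)\in\mathcal K(X)$.
   Context: Fix a metric $d$ on $X$ compatible with its topology. An iterated function system (IFS) on a metric space $(Y,d)$ is a finite collection $\mathcal F=\{f_1,\dots,f_m\}$, $m\ge1$, of continuous maps $Y\to Y$. $\mathcal I^m$ is the set of all finite words in the letters $1,\dots,m$ (including the empty word $0$); $|I|$ is the length of $I$. For $I=i_1\cdots i_k$, $\Phi^I_{\mathcal F}=f_{i_k}\circ\dots\circ f_{i_1}$, and $\Phi^0_{\mathcal F}=\mathrm{id}$. $H_{\mathcal F}(A)=\bigcup_{i=1}^m f_i(A)$; $A$ is $H$-invariant if $H_{\mathcal F}(A)=A$. The orbit of $x$ is $\mathcal O_{\mathcal F}(x)=\{\Phi^I_{\mathcal F}(x): I\in\mathcal I^m\}$. $\Omega_{\mathcal F}(A)$ is the set of $y$ for which there are $I_n\in\mathcal I^m$ and $a_n\in A$ with $|I_n|\to\infty$ and $\Phi^{I_n}_{\mathcal F}(a_n)\to y$. $N_\varepsilon(A)=\{x:d(x,A)<\varepsilon\}$. $A$ attracts $K$ if for every $\varepsilon>0$ there is $\tau>0$ with $\Phi^I_{\mathcal F}(K)\subset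 N_\varepsilon(A)$ for every $|I|\ge\tau$. A global attractor is a compact $H$-invariant set that attracts every compact subset of the space. $\mathcal F$ has compact dynamics if it has a global attractor. Chains: an $\varepsilon$-chain from $x$ to $y$ is a finite sequence $x_0=x,x_1,\dots,x_k=y$ ($k\ge0$) with indices $i_0,\dots,i_{k-1}$ such that $d(f_{i_n}(x_n),x_{n+1})<\varepsilon$ for $n=0,\dots,k-1$. Write $x\succcurlyeq y$ if for every $\varepsilon>0$ there is an $\varepsilon$-chain from $x$ to $y$; $x,y$ are chain-equivalent if $x\succcurlyeq y$ and $y\succcurlyeq x$. A point $x$ is chain-recurrent if it is chain-equivalent to $f_i(x)$ for some $i$; it is orbitwise chain-recurrent if it is chain-equivalent to every point of $\mathcal O_{\mathcal F}(x)$. Chain nodes (resp. orbitwise chain nodes) are the chain-equivalence classes of the set of chain-recurrent (resp. orbitwise chain-recurrent) points. $\mathcal K(X)$ is the space of all non-empty compact subsets of $X$ with the Hausdorff metric $d_H(A,B)=\max\{\sup_{a\in A}d(a,B),\sup_{b\in B}d(b,A)\}$. The Hutchinson map is $H_{\mathcal F}:\mathcal K(X)\to\mathcal K(X)$, $H_{\mathcal F}(K)=\bigcup_{i=1}^m f_i(K)$; its chain nodes are those of the one-generator IFS $\{H_{\mathcal F}\}$ on $(\mathcal K(X),d_H)$. For every orbitwise chain node $N$ of an IFS with compact dynamics, $\Omega_{\mathcal F}(N)$ is a non-empty compact $H$-invariant subset of $N$, hence a fixed point (in particular a chain-recurrent point) of $H_{\mathcal F}$. *)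

theory Defs
  imports "HOL-Analysis.Analysis"
begin

text \<open>
  An iterated function system is given by its number \<open>m\<close> of generators and the family
  \<open>f 1, \<dots>, f m\<close>.  Spaces are explicit carriers, so that the same chain notions apply
  to \<open>X\<close> and to the hyperspace \<open>\<K>(X)\<close>; values outside the carrier are irrelevant.
\<close>

definition ifs :: "'a topology \<Rightarrow> nat \<Rightarrow> (nat \<Rightarrow> 'a \<Rightarrow> 'a) \<Rightarrow> bool" where
  "ifs X m f \<longleftrightarrow> 1 \<le> m \<and> (\<forall>i\<in>{1..m}. continuous_map X X (f i))"

definition ifs_words :: "nat \<Rightarrow> nat list set" where
  "ifs_words m = lists {1..m}"

text \<open>
  \<open>fold\<close> applies the first letter first:
  \<open>ifs_comp f [i\<^sub>1, \<dots>, i\<^sub>k] = f i\<^sub>k \<circ> \<dots> \<circ> f i\<^sub>1\<close>, and \<open>ifs_comp f [] = id\<close>.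
\<close>

definition ifs_comp :: "(nat \<Rightarrow> 'a \<Rightarrow> 'a) \<Rightarrow> nat list \<Rightarrow> 'a \<Rightarrow> 'a" where
  "ifs_comp f w = fold f w"

definition hutchinson :: "nat \<Rightarrow> (nat \<Rightarrow> 'a \<Rightarrow> 'a) \<Rightarrow> 'a set \<Rightarrow> 'a set" where
  "hutchinson m f A = (\<Union>i\<in>{1..m}. f i ` A)"

definition ifs_orbit :: "nat \<Rightarrow> (nat \<Rightarrow> 'a \<Rightarrow> 'a) \<Rightarrow> 'a \<Rightarrow> 'a set" where
  "ifs_orbit m f x = {ifs_comp f w x | w. w \<in> ifs_words m}"

definition Omega_limit :: "'a topology \<Rightarrow> nat \<Rightarrow> (nat \<Rightarrow> 'a \<Rightarrow> 'a) \<Rightarrow> 'a set \<Rightarrow> 'a set" where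
  "Omega_limit X m f A =
     {y. \<exists>w a. (\<forall>n. w n \<in> ifs_words m) \<and> (\<forall>n. a n \<in> A) \<and>
               filterlim (\<lambda>n. length (w n)) at_top sequentially \<and>
               limitin X (\<lambda>n. ifs_comp f (w n) (a n)) y sequentially}"

subsection \<open>Attractors\<close>

definition point_set_dist :: "('a \<Rightarrow> 'a \<Rightarrow> real) \<Rightarrow> 'a \<Rightarrow> 'a set \<Rightarrow> real" where
  "point_set_dist d x A = (INF a\<in>A. d x a)"

text \<open>
  The distance to the empty set is infinite by convention, hence the guard: the real-valued
  infimum of the empty set is not meaningful.
\<close>

definition eps_nbhd :: "'a set \<Rightarrow> ('a \<Rightarrow> 'a \<Rightarrow> real) \<Rightarrow> real \<Rightarrow> 'a set \<Rightarrow> 'a set" where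
  "eps_nbhd M d \<epsilon> A = {x \<in> M. A \<noteq> {} \<and> point_set_dist d x A < \<epsilon>}"

definition attracts ::
  "'a set \<Rightarrow> ('a \<Rightarrow> 'a \<Rightarrow> real) \<Rightarrow> nat \<Rightarrow> (nat \<Rightarrow> 'a \<Rightarrow> 'a) \<Rightarrow> 'a set \<Rightarrow> 'a set \<Rightarrow> bool" where
  "attracts M d m f A K \<longleftrightarrow>
     (\<forall>\<epsilon>>0. \<exists>\<tau>>0. \<forall>w\<in>ifs_words m. \<tau> \<le> length w \<longrightarrow> ifs_comp f w ` K \<subseteq> eps_nbhd M d \<epsilon> A)"

definition global_attractor ::
  "'a topology \<Rightarrow> ('a \<Rightarrow> 'a \<Rightarrow> real) \<Rightarrow> nat \<Rightarrow> (nat \<Rightarrow> 'a \<Rightarrow> 'a) \<Rightarrow> 'a set \<Rightarrow> bool" where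
  "global_attractor X d m f A \<longleftrightarrow>
     compactin X A \<and> hutchinson m f A = A \<and>
     (\<forall>K. compactin X K \<longrightarrow> attracts (topspace X) d m f A K)"

definition compact_dynamics ::
  "'a topology \<Rightarrow> ('a \<Rightarrow> 'a \<Rightarrow> real) \<Rightarrow> nat \<Rightarrow> (nat \<Rightarrow> 'a \<Rightarrow> 'a) \<Rightarrow> bool" where
  "compact_dynamics X d m f \<longleftrightarrow> (\<exists>A. global_attractor X d m f A)"

subsection \<open>Chains\<close>

definition eps_chain ::
  "'a set \<Rightarrow> ('a \<Rightarrow> 'a \<Rightarrow> real) \<Rightarrow> nat \<Rightarrow> (nat \<Rightarrow> 'a \<Rightarrow> 'a) \<Rightarrow> real \<Rightarrow> 'a \<Rightarrow> 'a \<Rightarrow> bool" where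
  "eps_chain M d m f \<epsilon> x y \<longleftrightarrow>
     (\<exists>k p i. p 0 = x \<and> p k = y \<and> (\<forall>n\<le>k. p n \<in> M) \<and>
              (\<forall>n<k. i n \<in> {1..m} \<and> d (f (i n) (p n)) (p (Suc n)) < \<epsilon>))"

definition chain_ge ::
  "'a set \<Rightarrow> ('a \<Rightarrow> 'a \<Rightarrow> real) \<Rightarrow> nat \<Rightarrow> (nat \<Rightarrow> 'a \<Rightarrow> 'a) \<Rightarrow> 'a \<Rightarrow> 'a \<Rightarrow> bool" where
  "chain_ge M d m f x y \<longleftrightarrow> (\<forall>\<epsilon>>0. eps_chain M d m f \<epsilon> x y)"

definition chain_equiv ::
  "'a set \<Rightarrow> ('a \<Rightarrow> 'a \<Rightarrow> real) \<Rightarrow> nat \<Rightarrow> (nat \<Rightarrow> 'a \<Rightarrow> 'a) \<Rightarrow> 'a \<Rightarrow> 'a \<Rightarrow> bool" where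
  "chain_equiv M d m f x y \<longleftrightarrow> chain_ge M d m f x y \<and> chain_ge M d m f y x"

definition chain_recurrent_set ::
  "'a set \<Rightarrow> ('a \<Rightarrow> 'a \<Rightarrow> real) \<Rightarrow> nat \<Rightarrow> (nat \<Rightarrow> 'a \<Rightarrow> 'a) \<Rightarrow> 'a set" where
  "chain_recurrent_set M d m f = {x \<in> M. \<exists>i\<in>{1..m}. chain_equiv M d m f x (f i x)}"

definition orbitwise_chain_recurrent_set ::
  "'a set \<Rightarrow> ('a \<Rightarrow> 'a \<Rightarrow> real) \<Rightarrow> nat \<Rightarrow> (nat \<Rightarrow> 'a \<Rightarrow> 'a) \<Rightarrow> 'a set" where
  "orbitwise_chain_recurrent_set M d m f =
     {x \<in> M. \<forall>y\<in>ifs_orbit m f x. chain_equiv M d m f x y}"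

definition chain_equiv_rel ::
  "'a set \<Rightarrow> ('a \<Rightarrow> 'a \<Rightarrow> real) \<Rightarrow> nat \<Rightarrow> (nat \<Rightarrow> 'a \<Rightarrow> 'a) \<Rightarrow> 'a set \<Rightarrow> ('a \<times> 'a) set" where
  "chain_equiv_rel M d m f S = {(x, y). x \<in> S \<and> y \<in> S \<and> chain_equiv M d m f x y}"

definition chain_nodes ::
  "'a set \<Rightarrow> ('a \<Rightarrow> 'a \<Rightarrow> real) \<Rightarrow> nat \<Rightarrow> (nat \<Rightarrow> 'a \<Rightarrow> 'a) \<Rightarrow> 'a set set" where
  "chain_nodes M d m f =
     chain_recurrent_set M d m f // chain_equiv_rel M d m f (chain_recurrent_set M d m f)"

definition orbitwise_chain_nodes ::
  "'a set \<Rightarrow> ('a \<Rightarrow> 'a \<Rightarrow> real) \<Rightarrow> nat \<Rightarrow> (nat \<Rightarrow> 'a \<Rightarrow> 'a) \<Rightarrow> 'a set set" where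
  "orbitwise_chain_nodes M d m f =
     orbitwise_chain_recurrent_set M d m f //
       chain_equiv_rel M d m f (orbitwise_chain_recurrent_set M d m f)"

subsection \<open>The hyperspace of compact sets\<close>

definition hyperspace :: "'a topology \<Rightarrow> 'a set set" where
  "hyperspace X = {K. K \<noteq> {} \<and> compactin X K}"

text \<open>The suprema and infima are those of bounded non-empty sets when \<open>A, B \<in> hyperspace X\<close>.\<close>

definition hausdorff_dist :: "('a \<Rightarrow> 'a \<Rightarrow> real) \<Rightarrow> 'a set \<Rightarrow> 'a set \<Rightarrow> real" where
  "hausdorff_dist d A B =
     max (SUP a\<in>A. point_set_dist d a B) (SUP b\<in>B. point_set_dist d b A)"

definition hutchinson_chain_nodes ::
  "'a topology \<Rightarrow> ('a \<Rightarrow> 'a \<Rightarrow> real) \<Rightarrow> nat \<Rightarrow> (nat \<Rightarrow> 'a \<Rightarrow> 'a) \<Rightarrow> 'a set set set" where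
  "hutchinson_chain_nodes X d m f =
     chain_nodes (hyperspace X) (hausdorff_dist d) 1 (\<lambda>_. hutchinson m f)"

subsection \<open>Chain nodes partition the chain-recurrent set\<close>

lemma eps_chain_refl: "x \<in> M \<Longrightarrow> eps_chain M d m f \<epsilon> x x"
  unfolding eps_chain_def by (rule exI[of _ 0], rule exI[of _ "\<lambda>_. x"]) auto

lemma eps_chain_trans:
  assumes "eps_chain M d m f \<epsilon> x y" and "eps_chain M d m f \<epsilon> y z"
  shows "eps_chain M d m f \<epsilon> x z"
proof -
  obtain k p i where 1: "p 0 = x" "p k = y" "\<forall>n\<le>k. p n \<in> M"
    "\<forall>n<k. i n \<in> {1..m} \<and> d (f (i n) (p n)) (p (Suc n)) < \<epsilon>"
    using assms(1) unfolding eps_chain_def by blast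
  obtain l q j where 2: "q 0 = y" "q l = z" "\<forall>n\<le>l. q n \<in> M"
    "\<forall>n<l. j n \<in> {1..m} \<and> d (f (j n) (q n)) (q (Suc n)) < \<epsilon>"
    using assms(2) unfolding eps_chain_def by blast
  define r where "r = (\<lambda>n. if n \<le> k then p n else q (n - k))"
  define h where "h = (\<lambda>n. if n < k then i n else j (n - k))"
  have r_ge: "r n = q (n - k)" if "k \<le> n" for n
    using that 1(2) 2(1) by (cases "n = k") (auto simp: r_def)
  have "r 0 = x" "r (k + l) = z"
    using 1(1) 2(2) r_ge[of "k + l"] by (auto simp: r_def)
  moreover have "\<forall>n\<le>k + l. r n \<in> M"
    using 1(3) 2(3) by (auto simp: r_def)
  moreover have "h n \<in> {1..m} \<and> d (f (h n) (r n)) (r (Suc n)) < \<epsilon>" if "n < k + l" for n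
  proof (cases "n < k")
    case True
    then show ?thesis using 1(4) by (simp add: r_def h_def)
  next
    case False
    then have "n - k < l" using that by simp
    then show ?thesis
      using False 2(4) r_ge[of n] r_ge[of "Suc n"] by (simp add: h_def Suc_diff_le)
  qed
  ultimately show ?thesis unfolding eps_chain_def by blast
qed

lemma equiv_chain_equiv_rel:
  assumes "S \<subseteq> M" shows "equiv S (chain_equiv_rel M d m f S)"
proof (rule equivI)
  show "chain_equiv_rel M d m f S \<subseteq> S \<times> S"
    by (auto simp: chain_equiv_rel_def)
  show "refl_on S (chain_equiv_rel M d m f S)"
    using assms
    by (auto simp: refl_on_def chain_equiv_rel_def chain_equiv_def chain_ge_def
        intro!: eps_chain_refl)
  show "sym (chain_equiv_rel M d m f S)"
    by (auto simp: sym_def chain_equiv_rel_def chain_equiv_def)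
  have ge_trans: "chain_ge M d m f x z" if "chain_ge M d m f x y" "chain_ge M d m f y z" for x y z
    using that eps_chain_trans[of M d m f _ x y z] by (simp add: chain_ge_def)
  show "trans (chain_equiv_rel M d m f S)"
    by (rule transI) (auto simp: chain_equiv_rel_def chain_equiv_def intro: ge_trans)
qed

lemma ex1_chain_node:
  assumes "x \<in> chain_recurrent_set M d m f"
  shows "\<exists>!C. C \<in> chain_nodes M d m f \<and> x \<in> C"
proof -
  let ?S = "chain_recurrent_set M d m f" and ?r = "chain_equiv_rel M d m f (chain_recurrent_set M d m f)"
  have eq: "equiv ?S ?r"
    by (rule equiv_chain_equiv_rel) (auto simp: chain_recurrent_set_def)
  have "?r `` {x} \<in> ?S // ?r" "x \<in> ?r `` {x}"
    using quotientI[OF assms] equiv_class_self[OF eq assms] by auto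
  moreover have "C = D" if "C \<in> ?S // ?r" "D \<in> ?S // ?r" "x \<in> C" "x \<in> D" for C D
    using quotient_disj[OF eq that(1,2)] that(3,4) by blast
  ultimately show ?thesis unfolding chain_nodes_def by blast
qed

end

theory Submission
  imports Defs
begin

text \<open>
  A compact forward invariant set \<open>N\<close> has \<open>\<Omega>(N) = \<Inter>\<^sub>n H\<^sup>n(N)\<close>, which is non-empty, compact,
  \<open>H\<close>-invariant and contained in \<open>N\<close>.  Orbitwise chain nodes are compact: they are closed and forward
  invariant, and chain-recurrent points lie in the global attractor, because \<open>\<epsilon>\<close>-chains that start
  near the attractor shadow true orbits over a fixed time and hence never leave a neighbourhood of it.
  Finally an \<open>\<epsilon>\<close>-chain of \<open>H\<close> from \<open>A\<close> to \<open>B\<close> can be traced back from any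
  \<open>b \<in> B\<close> to an \<open>\<epsilon>\<close>-chain of the system from some \<open>a \<in> A\<close> to \<open>b\<close>.  So chain equivalence of
  \<open>\<Omega>(N\<^sub>1)\<close> and \<open>\<Omega>(N\<^sub>2)\<close> forces that of the points of \<open>N\<^sub>1\<close> and \<open>N\<^sub>2\<close>.
\<close>

subsection \<open>Words and iterates of the Hutchinson map\<close>

lemma ifs_comp_Nil [simp]: "ifs_comp f [] x = x"
  by (simp add: ifs_comp_def)

lemma ifs_comp_append [simp]: "ifs_comp f (v @ w) x = ifs_comp f w (ifs_comp f v x)"
  by (simp add: ifs_comp_def)

lemma ifs_comp_Cons [simp]: "ifs_comp f (i # w) x = ifs_comp f w (f i x)"
  by (simp add: ifs_comp_def)

lemma ifs_words_Nil [simp]: "[] \<in> ifs_words m"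
  by (simp add: ifs_words_def)

lemma ifs_words_Cons [simp]: "i # w \<in> ifs_words m \<longleftrightarrow> i \<in> {1..m} \<and> w \<in> ifs_words m"
  by (auto simp: ifs_words_def)

lemma ifs_words_append [simp]:
  "v @ w \<in> ifs_words m \<longleftrightarrow> v \<in> ifs_words m \<and> w \<in> ifs_words m"
  by (auto simp: ifs_words_def)

lemma hutchinson_mono: "A \<subseteq> B \<Longrightarrow> hutchinson m f A \<subseteq> hutchinson m f B"
  by (auto simp: hutchinson_def)

text \<open>Since \<open>fold\<close> applies the last letter last, one more application of
  \<open>hutchinson\<close> appends a letter at the right end of the word. Statements on words of
  length \<open>n\<close> thus become statements on iterates.\<close>

lemma hutchinson_iterate_eq:
  "(hutchinson m f ^^ n) A = {ifs_comp f w a | w a. w \<in> ifs_words m \<and> length w = n \<and> a \<in> A}"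
proof (induction n)
  case (Suc n)
  show ?case
  proof (intro subset_antisym subsetI)
    fix y assume "y \<in> (hutchinson m f ^^ Suc n) A"
    then obtain i w a where "i \<in> {1..m}" "w \<in> ifs_words m" "length w = n" "a \<in> A"
      "y = f i (ifs_comp f w a)"
      using Suc by (auto simp: hutchinson_def)
    then have "y = ifs_comp f (w @ [i]) a" "w @ [i] \<in> ifs_words m" "length (w @ [i]) = Suc n"
      by auto
    with \<open>a \<in> A\<close> show "y \<in> {ifs_comp f w a | w a. w \<in> ifs_words m \<and> length w = Suc n \<and> a \<in> A}"
      by blast
  next
    fix y assume "y \<in> {ifs_comp f w a | w a. w \<in> ifs_words m \<and> length w = Suc n \<and> a \<in> A}"
    then obtain w a where w: "w \<in> ifs_words m" "length w = Suc n" "a \<in> A" "y = ifs_comp f w a"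
      by blast
    then obtain v i where v: "w = v @ [i]"
      by (metis Zero_not_Suc length_0_conv rev_exhaust)
    with w have "ifs_comp f v a \<in> (hutchinson m f ^^ n) A" "i \<in> {1..m}"
      using Suc by auto
    then show "y \<in> (hutchinson m f ^^ Suc n) A"
      using w v by (auto simp: hutchinson_def)
  qed
qed auto

lemma hutchinson_iterate_antimono:
  assumes "hutchinson m f A \<subseteq> A" "k \<le> n"
  shows "(hutchinson m f ^^ n) A \<subseteq> (hutchinson m f ^^ k) A"
  using assms(2)
proof (induction rule: dec_induct)
  case (step n)
  have "(hutchinson m f ^^ Suc n) A \<subseteq> (hutchinson m f ^^ n) A" for n
    using assms(1) by (induction n) (simp, simp only: funpow.simps o_apply hutchinson_mono)
  with step show ?case by blast
qed auto

section \<open>Iterated function systems on a metric space\<close>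

locale metric_ifs = Metric_space M d for M :: "'a set" and d :: "'a \<Rightarrow> 'a \<Rightarrow> real" +
  fixes m :: nat and f :: "nat \<Rightarrow> 'a \<Rightarrow> 'a"
  assumes ifs: "ifs mtopology m f"
begin

lemma one_generator: "1 \<in> {1..m}"
  using ifs by (simp add: ifs_def)

lemma continuous_generator: "i \<in> {1..m} \<Longrightarrow> continuous_map mtopology mtopology (f i)"
  using ifs by (simp add: ifs_def)

lemma generator_in: "i \<in> {1..m} \<Longrightarrow> x \<in> M \<Longrightarrow> f i x \<in> M"
  using continuous_generator[of i] by (auto simp: continuous_map_def)

lemma continuous_comp:
  "w \<in> ifs_words m \<Longrightarrow> continuous_map mtopology mtopology (ifs_comp f w)"
proof (induction w)
  case (Cons i w)
  then have "continuous_map mtopology mtopology (ifs_comp f w \<circ> f i)"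
    using continuous_generator continuous_map_compose by (metis ifs_words_Cons)
  then show ?case by (simp add: o_def)
qed (simp add: ifs_comp_def id_def)

lemma comp_in: "w \<in> ifs_words m \<Longrightarrow> x \<in> M \<Longrightarrow> ifs_comp f w x \<in> M"
  using continuous_comp[of w] by (auto simp: continuous_map_def)

lemma compactin_hutchinson: "compactin mtopology A \<Longrightarrow> compactin mtopology (hutchinson m f A)"
  unfolding hutchinson_def
  by (intro compactin_Union finite_imageI) (auto intro!: image_compactin[OF _ continuous_generator])

lemma compactin_hutchinson_iterate:
  "compactin mtopology A \<Longrightarrow> compactin mtopology ((hutchinson m f ^^ n) A)"
  by (induction n) (auto intro: compactin_hutchinson)

lemma hutchinson_nonempty: "A \<noteq> {} \<Longrightarrow> hutchinson m f A \<noteq> {}"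
  using one_generator by (auto simp: hutchinson_def)

lemma hutchinson_iterate_nonempty: "A \<noteq> {} \<Longrightarrow> (hutchinson m f ^^ n) A \<noteq> {}"
  by (induction n) (simp_all add: hutchinson_nonempty)

subsection \<open>Omega limits of compact forward invariant sets\<close>

text \<open>Words of length at least \<open>k\<close> send \<open>N\<close> into its
  \<open>k\<close>-th iterate, which is compact, hence closed, and so contains every limit of such
  images.\<close>

lemma Omega_limit_eq_Inter:
  assumes "compactin mtopology N" "hutchinson m f N \<subseteq> N"
  shows "Omega_limit mtopology m f N = (\<Inter>n. (hutchinson m f ^^ n) N)"
proof (intro subset_antisym subsetI INT_I)
  fix y k
  assume "y \<in> Omega_limit mtopology m f N"
  then obtain w a where w: "\<And>n. w n \<in> ifs_words m" "\<And>n. a n \<in> N"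
    and lim: "filterlim (\<lambda>n. length (w n)) at_top sequentially"
      "limitin mtopology (\<lambda>n. ifs_comp f (w n) (a n)) y sequentially"
    unfolding Omega_limit_def by auto
  have "\<forall>\<^sub>F n in sequentially. k \<le> length (w n)"
    using lim(1) by (simp add: filterlim_at_top)
  then have "\<forall>\<^sub>F n in sequentially. ifs_comp f (w n) (a n) \<in> (hutchinson m f ^^ k) N"
  proof eventually_elim
    case (elim n)
    have "ifs_comp f (w n) (a n) \<in> (hutchinson m f ^^ length (w n)) N"
      using w by (auto simp: hutchinson_iterate_eq)
    then show ?case
      using hutchinson_iterate_antimono[OF assms(2) elim] by blast
  qed
  moreover have "closedin mtopology ((hutchinson m f ^^ k) N)"
    using assms(1) compactin_hutchinson_iterate compactin_imp_closedin Hausdorff_space_mtopology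
    by blast
  ultimately show "y \<in> (hutchinson m f ^^ k) N"
    using limitin_closedin[OF lim(2)] by simp
next
  fix y assume y: "y \<in> (\<Inter>n. (hutchinson m f ^^ n) N)"
  \<comment> \<open>For the converse the approximating sequence is constantly \<open>y\<close>,
    written for each \<open>n\<close> as an image under a word of length exactly
    \<open>n\<close>.\<close>
  have "\<forall>n. \<exists>w a. w \<in> ifs_words m \<and> length w = n \<and> a \<in> N \<and> y = ifs_comp f w a"
    using y unfolding hutchinson_iterate_eq by blast
  then obtain w a where w: "\<And>n. w n \<in> ifs_words m" "\<And>n. length (w n) = n" "\<And>n. a n \<in> N"
    "\<And>n. ifs_comp f (w n) (a n) = y"
    by metis
  have "y \<in> N"
    using INT_D[OF y, of 0] by simp
  then have "y \<in> M"
    using assms(1) compactin_subset_topspace by fastforce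
  with w show "y \<in> Omega_limit mtopology m f N"
    unfolding Omega_limit_def
    by (intro CollectI exI[of _ w] exI[of _ a]) (auto simp: filterlim_ident)
qed

lemma Omega_limit_subset:
  assumes "compactin mtopology N" "hutchinson m f N \<subseteq> N"
  shows "Omega_limit mtopology m f N \<subseteq> N"
  using Omega_limit_eq_Inter[OF assms] by (metis INT_lower UNIV_I funpow_0)

text \<open>Cantor's intersection theorem, obtained inside the compact subspace \<open>C 0\<close>.
  It yields both points of the omega limit and preimages common to all stages.\<close>

lemma nested_compactin_nonempty:
  fixes C :: "nat \<Rightarrow> 'a set"
  assumes "\<And>n. compactin mtopology (C n)" "\<And>n. C n \<noteq> {}" "decseq C"
  shows "(\<Inter>n. C n) \<noteq> {}"
proof (rule compact_space_imp_nest[OF _ _ assms(2,3)])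
  show "compact_space (subtopology mtopology (C 0))"
    using assms(1) compact_space_subtopology by blast
  show "closedin (subtopology mtopology (C 0)) (C n)" for n
    using assms decseqD[OF assms(3), of 0 n]
    by (meson Hausdorff_space_mtopology closedin_subset_topspace compactin_imp_closedin le0)
qed

lemma decseq_hutchinson_iterate:
  "hutchinson m f N \<subseteq> N \<Longrightarrow> decseq (\<lambda>n. (hutchinson m f ^^ n) N)"
  by (simp add: decseq_def hutchinson_iterate_antimono)

lemma Omega_limit_nonempty:
  assumes "compactin mtopology N" "hutchinson m f N \<subseteq> N" "N \<noteq> {}"
  shows "Omega_limit mtopology m f N \<noteq> {}"
  unfolding Omega_limit_eq_Inter[OF assms(1,2)]
  using assms
  by (intro nested_compactin_nonempty decseq_hutchinson_iterate compactin_hutchinson_iterate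
      hutchinson_iterate_nonempty)

lemma compactin_Omega_limit:
  assumes "compactin mtopology N" "hutchinson m f N \<subseteq> N"
  shows "compactin mtopology (Omega_limit mtopology m f N)"
proof (rule closed_compactin[OF assms(1) Omega_limit_subset[OF assms]])
  show "closedin mtopology (Omega_limit mtopology m f N)"
    unfolding Omega_limit_eq_Inter[OF assms]
    by (intro closedin_INT)
      (use assms compactin_hutchinson_iterate compactin_imp_closedin Hausdorff_space_mtopology
        in blast)+
qed

text \<open>The inclusion from right to left is the substantial one: at each stage \<open>y\<close>
  has a preimage under some generator, finiteness lets one generator serve all stages, and
  compactness gives a preimage lying in every iterate.\<close>

lemma hutchinson_Omega_limit:
  assumes "compactin mtopology N" "hutchinson m f N \<subseteq> N"
  shows "hutchinson m f (Omega_limit mtopology m f N) = Omega_limit mtopology m f N"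
  unfolding Omega_limit_eq_Inter[OF assms]
proof (intro subset_antisym subsetI)
  let ?H = "\<lambda>n. (hutchinson m f ^^ n) N"
  fix y assume "y \<in> hutchinson m f (\<Inter>n. ?H n)"
  then have "y \<in> ?H (Suc n)" for n
    by (auto simp: hutchinson_def)
  then show "y \<in> (\<Inter>n. ?H n)"
    using hutchinson_iterate_antimono[OF assms(2) le_SucI[OF order_refl]] by blast
next
  let ?H = "\<lambda>n. (hutchinson m f ^^ n) N"
  fix y assume y: "y \<in> (\<Inter>n. ?H n)"
  have yM: "y \<in> M"
    using y compactin_hutchinson_iterate[OF assms(1), THEN compactin_subset_topspace] by auto
  \<comment> \<open>The preimages of \<open>y\<close> under \<open>f i\<close> at stage
    \<open>n\<close>, phrased with the closed singleton \<open>{y}\<close> so that continuity makes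
    them closed.\<close>
  define C where "C = (\<lambda>i n. {x \<in> ?H n. f i x \<in> {y}})"
  have dec: "decseq (C i)" for i
    using hutchinson_iterate_antimono[OF assms(2)] by (fastforce simp: decseq_def C_def)
  \<comment> \<open>Otherwise each decreasing sequence \<open>C i\<close> is empty from some stage
    \<open>k i\<close> on. At the largest of these stages, \<open>K\<close>, all are empty,
    contradicting that \<open>y\<close> lies in iterate \<open>Suc K\<close>.\<close>
  have "\<exists>i\<in>{1..m}. \<forall>n. C i n \<noteq> {}"
  proof (rule ccontr)
    assume "\<not> ?thesis"
    then obtain k where k: "\<And>i. i \<in> {1..m} \<Longrightarrow> C i (k i) = {}"
      by metis
    define K where "K = Max (k ` {1..m})"
    have "C i K = {}" if "i \<in> {1..m}" for i
      using decseqD[OF dec, of "k i" K i] k[OF that] that by (auto simp: K_def)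
    moreover have "y \<in> ?H (Suc K)"
      using y by blast
    then obtain i x where "i \<in> {1..m}" "x \<in> ?H K" "y = f i x"
      by (auto simp: hutchinson_def)
    ultimately show False
      by (auto simp: C_def)
  qed
  then obtain i where i: "i \<in> {1..m}" "\<And>n. C i n \<noteq> {}"
    by blast
  have "compactin mtopology (C i n)" for n
  proof (rule closed_compactin)
    show "compactin mtopology (?H n)"
      by (rule compactin_hutchinson_iterate[OF assms(1)])
    then show "closedin mtopology (C i n)"
      unfolding C_def using continuous_generator[OF i(1)] yM
      by (intro closedin_continuous_map_preimage_gen)
        (auto simp: compactin_imp_closedin Hausdorff_space_mtopology closedin_Hausdorff_singleton)
  qed (auto simp: C_def)
  then have "(\<Inter>n. C i n) \<noteq> {}"
    using i(2) dec by (rule nested_compactin_nonempty)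
  then obtain x where "\<And>n. x \<in> C i n"
    by blast
  then have "f i x = y" "x \<in> (\<Inter>n. ?H n)"
    by (auto simp: C_def)
  then show "y \<in> hutchinson m f (\<Inter>n. ?H n)"
    using i(1) unfolding hutchinson_def by blast
qed

subsection \<open>Chains\<close>

lemma chain_ge_refl: "x \<in> M \<Longrightarrow> chain_ge M d m f x x"
  by (simp add: chain_ge_def eps_chain_refl)

lemma chain_ge_trans:
  "chain_ge M d m f x y \<Longrightarrow> chain_ge M d m f y z \<Longrightarrow> chain_ge M d m f x z"
  unfolding chain_ge_def using eps_chain_trans[of M d m f _ x y z] by simp

lemma eps_chain_step:
  assumes "x \<in> M" "y \<in> M" "i \<in> {1..m}" "d (f i x) y < \<epsilon>"
  shows "eps_chain M d m f \<epsilon> x y"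
  unfolding eps_chain_def using assms
  by (intro exI[of _ "Suc 0"] exI[of _ "\<lambda>n. if n = 0 then x else y"] exI[of _ "\<lambda>_. i"])
    (auto simp: le_Suc_eq)

text \<open>The gain over reflexivity is the positive length: the chain from \<open>f j x\<close>
  back to \<open>x\<close> is preceded by the exact step from \<open>x\<close> to
  \<open>f j x\<close>, whose error is zero.\<close>

lemma chain_recurrent_loop:
  assumes "x \<in> chain_recurrent_set M d m f" "0 < \<epsilon>"
  obtains L p i where "0 < L" "p 0 = x" "p L = x" "\<And>n. n \<le> L \<Longrightarrow> p n \<in> M"
    "\<And>n. n < L \<Longrightarrow> i n \<in> {1..m} \<and> d (f (i n) (p n)) (p (Suc n)) < \<epsilon>"
proof -
  obtain j where j: "x \<in> M" "j \<in> {1..m}" "eps_chain M d m f \<epsilon> (f j x) x"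
    using assms by (auto simp: chain_recurrent_set_def chain_equiv_def chain_ge_def)
  obtain k q h where q: "q 0 = f j x" "q k = x" "\<And>n. n \<le> k \<Longrightarrow> q n \<in> M"
    "\<And>n. n < k \<Longrightarrow> h n \<in> {1..m} \<and> d (f (h n) (q n)) (q (Suc n)) < \<epsilon>"
    using j(3) unfolding eps_chain_def by metis
  show thesis
  proof (rule that[of "Suc k" "case_nat x q" "case_nat j h"])
    show "case_nat x q n \<in> M" if "n \<le> Suc k" for n
      using that q j by (auto split: nat.split)
    show "case_nat j h n \<in> {1..m} \<and>
        d (f (case_nat j h n) (case_nat x q n)) (case_nat x q (Suc n)) < \<epsilon>" if "n < Suc k" for n
      using that q j assms(2) generator_in[OF j(2,1)] by (cases n) auto
  qed (use q in auto)
qed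

text \<open>A loop at \<open>x\<close> with the smaller tolerance \<open>\<epsilon> - d x y\<close>
  leaves room to move its last point to \<open>y\<close>. Recurrence is what supplies a last step
  that can absorb the error.\<close>

lemma eps_chain_perturb_end:
  assumes "x \<in> chain_recurrent_set M d m f" "y \<in> M" "d x y < \<epsilon>"
  shows "eps_chain M d m f \<epsilon> x y"
proof -
  have xM: "x \<in> M"
    using assms(1) by (auto simp: chain_recurrent_set_def)
  define \<delta> where "\<delta> = \<epsilon> - d x y"
  have "0 < \<delta>" using assms(3) by (simp add: \<delta>_def)
  obtain L p i where L: "0 < L" "p 0 = x" "p L = x" "\<And>n. n \<le> L \<Longrightarrow> p n \<in> M"
    "\<And>n. n < L \<Longrightarrow> i n \<in> {1..m} \<and> d (f (i n) (p n)) (p (Suc n)) < \<delta>"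
    using chain_recurrent_loop[OF assms(1) \<open>0 < \<delta>\<close>] by metis
  have \<delta>: "\<delta> \<le> \<epsilon>" by (simp add: \<delta>_def)
  have "d (f (i n) (p n)) ((p(L := y)) (Suc n)) < \<epsilon>" if "n < L" for n
  proof (cases "Suc n = L")
    case True
    have "f (i n) (p n) \<in> M"
      using L(4,5) that generator_in by simp
    then have "d (f (i n) (p n)) y \<le> d (f (i n) (p n)) x + d x y"
      using xM assms(2) triangle by blast
    then show ?thesis
      using True L(3) L(5)[OF that] by (auto simp: \<delta>_def)
  next
    case False
    then show ?thesis using L(5)[OF that] \<delta> by auto
  qed
  then show ?thesis
    unfolding eps_chain_def using L assms(2)
    by (intro exI[of _ L] exI[of _ "p(L := y)"] exI[of _ i]) auto
qed

subsection \<open>Chain-recurrent points lie in the global attractor\<close>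

text \<open>Only \<open>a\<close> is confined to \<open>K\<close>, while \<open>b\<close> ranges
  over the whole space, as chain points may leave \<open>K\<close>. The constant is a Lebesgue
  number for the cover of \<open>K\<close> by preimages of balls of radius
  \<open>\<rho> / 2\<close>.\<close>

lemma uniformly_continuous_at_compact:
  assumes "compactin mtopology K" "continuous_map mtopology mtopology g" "0 < \<rho>"
  obtains \<delta> where "0 < \<delta>" "\<And>a b. a \<in> K \<Longrightarrow> b \<in> M \<Longrightarrow> d a b < \<delta> \<Longrightarrow> d (g a) (g b) < \<rho>"
proof -
  let ?U = "\<lambda>c. {b \<in> M. g b \<in> mball (g c) (\<rho> / 2)}"
  have KM: "K \<subseteq> M"
    using compactin_subset_topspace[OF assms(1)] by simp
  have gM: "x \<in> M \<Longrightarrow> g x \<in> M" for x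
    using assms(2) by (auto simp: continuous_map_def)
  have "openin mtopology (?U c)" for c
    using openin_continuous_map_preimage[OF assms(2) openin_mball] by (simp del: in_mball)
  moreover have "x \<in> ?U x" if "x \<in> K" for x
    using KM gM assms(3) that by auto
  then have "K \<subseteq> \<Union>(?U ` K)"
    by blast
  ultimately have "\<exists>\<delta>>0. \<forall>x\<in>K. \<exists>U\<in>?U ` K. mball x \<delta> \<subseteq> U"
    by (intro lebesgue_number[OF assms(1)]) blast+
  then obtain \<delta> where \<delta>: "0 < \<delta>" "\<And>x. x \<in> K \<Longrightarrow> \<exists>c\<in>K. mball x \<delta> \<subseteq> ?U c"
    by blast
  have "d (g a) (g b) < \<rho>" if ab: "a \<in> K" "b \<in> M" "d a b < \<delta>" for a b
  proof -
    obtain c where c: "c \<in> K" "mball a \<delta> \<subseteq> ?U c"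
      using \<delta>(2)[OF ab(1)] by blast
    have "a \<in> mball a \<delta>" "b \<in> mball a \<delta>"
      using ab \<delta>(1) KM by auto
    then have "a \<in> ?U c" "b \<in> ?U c"
      using c(2) by blast+
    then have "d (g c) (g a) < \<rho> / 2" "d (g c) (g b) < \<rho> / 2"
      by auto
    moreover have "d (g a) (g b) \<le> d (g c) (g a) + d (g c) (g b)"
      using gM KM c(1) ab by (intro triangle'') auto
    ultimately show ?thesis by simp
  qed
  with \<delta>(1) show thesis by (rule that)
qed

lemma generators_uniformly_continuous_at_compact:
  assumes "compactin mtopology K" "0 < \<rho>"
  obtains \<delta> where "0 < \<delta>"
    "\<And>i a b. i \<in> {1..m} \<Longrightarrow> a \<in> K \<Longrightarrow> b \<in> M \<Longrightarrow> d a b < \<delta> \<Longrightarrow> d (f i a) (f i b) < \<rho>"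
proof -
  have "\<forall>i\<in>{1..m}. \<exists>\<delta>>0. \<forall>a\<in>K. \<forall>b\<in>M. d a b < \<delta> \<longrightarrow> d (f i a) (f i b) < \<rho>"
    using uniformly_continuous_at_compact[OF assms(1) continuous_generator assms(2)] by metis
  then obtain D where D: "\<And>i. i \<in> {1..m} \<Longrightarrow> 0 < D i"
    "\<And>i a b. i \<in> {1..m} \<Longrightarrow> a \<in> K \<Longrightarrow> b \<in> M \<Longrightarrow> d a b < D i \<Longrightarrow> d (f i a) (f i b) < \<rho>"
    by metis
  have ne: "D ` {1..m} \<noteq> {}"
    using one_generator by blast
  show thesis
  proof (rule that[of "Min (D ` {1..m})"])
    show "0 < Min (D ` {1..m})"
      using D(1) ne by (simp del: image_is_empty)
    show "d (f i a) (f i b) < \<rho>"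
      if "i \<in> {1..m}" "a \<in> K" "b \<in> M" "d a b < Min (D ` {1..m})" for i a b
      using that D(2)[OF that(1-3)] ne by (auto simp del: image_is_empty)
  qed
qed

text \<open>Induction on \<open>n\<close>: the error accumulated so far is propagated by one
  generator, and one new jump is added, each costing at most \<open>\<rho> / 2\<close>.\<close>

lemma chain_shadowing:
  assumes "compactin mtopology K" "0 < \<rho>"
  obtains \<epsilon> where "0 < \<epsilon>"
    "\<And>p i. \<lbrakk>p 0 \<in> K; \<And>j. j \<le> n \<Longrightarrow> p j \<in> M;
       \<And>j. j < n \<Longrightarrow> i j \<in> {1..m} \<and> d (f (i j) (p j)) (p (Suc j)) < \<epsilon>\<rbrakk>
       \<Longrightarrow> d (ifs_comp f (map i [0..<n]) (p 0)) (p n) < \<rho>"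
  using assms(2)
proof (induction n arbitrary: \<rho> thesis)
  case 0
  show ?case
    by (rule "0.prems"(1)[of 1]) (use 0 in auto)
next
  case (Suc n)
  \<comment> \<open>The true orbit after \<open>n\<close> steps stays in the compact
    \<open>n\<close>-th iterate of \<open>K\<close>, so uniform continuity is applied there and not
    at the chain point \<open>p n\<close>.\<close>
  obtain \<delta> where \<delta>: "0 < \<delta>" "\<And>i a b. i \<in> {1..m} \<Longrightarrow> a \<in> (hutchinson m f ^^ n) K \<Longrightarrow> b \<in> M
      \<Longrightarrow> d a b < \<delta> \<Longrightarrow> d (f i a) (f i b) < \<rho> / 2"
    using generators_uniformly_continuous_at_compact[OF compactin_hutchinson_iterate[OF assms(1)],
        of "\<rho> / 2" n] Suc.prems(2) by (metis half_gt_zero)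
  obtain \<epsilon> where \<epsilon>: "0 < \<epsilon>" "\<And>p i. \<lbrakk>p 0 \<in> K; \<And>j. j \<le> n \<Longrightarrow> p j \<in> M;
       \<And>j. j < n \<Longrightarrow> i j \<in> {1..m} \<and> d (f (i j) (p j)) (p (Suc j)) < \<epsilon>\<rbrakk>
       \<Longrightarrow> d (ifs_comp f (map i [0..<n]) (p 0)) (p n) < \<delta>"
    using Suc.IH[OF _ \<delta>(1)] by metis
  show ?case
  proof (rule Suc.prems(1)[of "min \<epsilon> (\<rho> / 2)"])
    show "0 < min \<epsilon> (\<rho> / 2)"
      using \<epsilon>(1) Suc.prems(2) by simp
    fix p i
    assume p: "p 0 \<in> K" "\<And>j. j \<le> Suc n \<Longrightarrow> p j \<in> M"
      "\<And>j. j < Suc n \<Longrightarrow> i j \<in> {1..m} \<and> d (f (i j) (p j)) (p (Suc j)) < min \<epsilon> (\<rho> / 2)"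
    define w where "w = map i [0..<n]"
    have w: "w \<in> ifs_words m" "length w = n"
      using p(3) by (auto simp: w_def ifs_words_def)
    have inH: "ifs_comp f w (p 0) \<in> (hutchinson m f ^^ n) K"
      using w p(1) by (auto simp: hutchinson_iterate_eq)
    have n: "i n \<in> {1..m}" "d (f (i n) (p n)) (p (Suc n)) < \<rho> / 2" "p n \<in> M" "p (Suc n) \<in> M"
      using p(3)[of n] p(2) by auto
    have "d (ifs_comp f w (p 0)) (p n) < \<delta>"
      unfolding w_def using p by (intro \<epsilon>(2)) auto
    then have "d (f (i n) (ifs_comp f w (p 0))) (f (i n) (p n)) < \<rho> / 2"
      using \<delta>(2) n inH by blast
    moreover have "ifs_comp f w (p 0) \<in> M"
      using w comp_in p(2)[of 0] by simp
    ultimately have "d (f (i n) (ifs_comp f w (p 0))) (p (Suc n)) < \<rho>"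
      using triangle[of "f (i n) (ifs_comp f w (p 0))" "f (i n) (p n)" "p (Suc n)"] n generator_in
      by fastforce
    then show "d (ifs_comp f (map i [0..<Suc n]) (p 0)) (p (Suc n)) < \<rho>"
      by (simp add: w_def)
  qed
qed

text \<open>A loop at \<open>x\<close> is sampled every \<open>T\<close> steps, where
  \<open>T\<close> is an attraction time of a compact neighbourhood \<open>U\<close> of
  \<open>x\<close> and \<open>G\<close>. All samples stay in \<open>U\<close>, and a later sample is
  \<open>x\<close> itself, which is thereby close to \<open>G\<close>.\<close>

lemma chain_recurrent_in_attractor:
  assumes "locally_compact_space mtopology" "global_attractor mtopology d m f G"
    and x: "x \<in> chain_recurrent_set M d m f"
  shows "x \<in> G"
proof -
  have G: "compactin mtopology G" and att: "\<And>K. compactin mtopology K \<Longrightarrow> attracts M d m f G K"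
    using assms(2) by (auto simp: global_attractor_def)
  have xM: "x \<in> M"
    using x by (auto simp: chain_recurrent_set_def)
  have GM: "G \<subseteq> M"
    using compactin_subset_topspace[OF G] by simp
  \<comment> \<open>Including \<open>x\<close> makes the loop start inside \<open>U\<close>.\<close>
  have "compactin mtopology (insert x G)"
    using compactin_Un[of mtopology "{x}" G] G xM by (simp add: compactin_sing)
  then obtain W U where W: "openin mtopology W" "compactin mtopology U" "insert x G \<subseteq> W" "W \<subseteq> U"
    using assms(1) locally_compact_space_compact_closed_compact Hausdorff_space_mtopology by metis
  \<comment> \<open>The Lebesgue number of the one-element cover \<open>{W}\<close> of
    \<open>G\<close> is a uniform radius for balls about \<open>G\<close> inside
    \<open>U\<close>.\<close>
  have "\<exists>\<eta>>0. \<forall>g\<in>G. \<exists>V\<in>{W}. mball g \<eta> \<subseteq> V"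
    by (rule lebesgue_number[OF G]) (use W in auto)
  then obtain \<eta>\<^sub>0 where \<eta>\<^sub>0: "0 < \<eta>\<^sub>0" "\<And>g. g \<in> G \<Longrightarrow> mball g \<eta>\<^sub>0 \<subseteq> U"
    using W(4) by blast
  have near: "\<exists>g\<in>G. d g x < r" if "0 < r" for r
  proof -
    \<comment> \<open>The bound by \<open>r\<close> gives the required closeness, the bound by
      \<open>\<eta>\<^sub>0\<close> keeps the samples in \<open>U\<close>.\<close>
    define \<eta> where "\<eta> = min r \<eta>\<^sub>0"
    have \<eta>: "0 < \<eta>" "\<eta> \<le> r" "\<eta> \<le> \<eta>\<^sub>0"
      using that \<eta>\<^sub>0(1) by (auto simp: \<eta>_def)
    have "\<exists>\<tau>>0. \<forall>w\<in>ifs_words m. \<tau> \<le> length w \<longrightarrow> ifs_comp f w ` U \<subseteq> eps_nbhd M d (\<eta> / 2) G"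
      using att[OF W(2)] \<eta>(1) by (simp add: attracts_def)
    then obtain T where T: "0 < T"
      "\<And>w. w \<in> ifs_words m \<Longrightarrow> T \<le> length w \<Longrightarrow> ifs_comp f w ` U \<subseteq> eps_nbhd M d (\<eta> / 2) G"
      by auto
    have attT: "\<exists>g\<in>G. d (ifs_comp f w u) g < \<eta> / 2"
      if "w \<in> ifs_words m" "T = length w" "u \<in> U" for w u
    proof -
      have "ifs_comp f w u \<in> eps_nbhd M d (\<eta> / 2) G"
        using T(2)[OF that(1)] that by auto
      \<comment> \<open>Non-emptiness comes from the guard in \<open>eps_nbhd\<close> and makes the
        infimum meaningful.\<close>
      then have "G \<noteq> {}" "(INF g\<in>G. d (ifs_comp f w u) g) < \<eta> / 2"
        by (auto simp: eps_nbhd_def point_set_dist_def)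
      then show ?thesis
        using cInf_lessD[of "d (ifs_comp f w u) ` G"] by blast
    qed
    obtain \<epsilon> where \<epsilon>: "0 < \<epsilon>" "\<And>p i. \<lbrakk>p 0 \<in> U; \<And>j. j \<le> T \<Longrightarrow> p j \<in> M;
       \<And>j. j < T \<Longrightarrow> i j \<in> {1..m} \<and> d (f (i j) (p j)) (p (Suc j)) < \<epsilon>\<rbrakk>
       \<Longrightarrow> d (ifs_comp f (map i [0..<T]) (p 0)) (p T) < \<eta> / 2"
      using chain_shadowing[OF W(2), of "\<eta> / 2" T] \<eta>(1) by (metis half_gt_zero)
    obtain L p i where L: "0 < L" "p 0 = x" "p L = x" "\<And>n. n \<le> L \<Longrightarrow> p n \<in> M"
      "\<And>n. n < L \<Longrightarrow> i n \<in> {1..m} \<and> d (f (i n) (p n)) (p (Suc n)) < \<epsilon>"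
      using chain_recurrent_loop[OF x \<epsilon>(1)] by metis
    \<comment> \<open>The loop is run through \<open>T\<close> times, so that its length is a multiple of the attraction time.\<close>
    define q where "q = (\<lambda>n. p (n mod L))"
    define h where "h = (\<lambda>n. i (n mod L))"
    have qM: "q n \<in> M" for n
      using L(1,4) by (simp add: q_def)
    have qs: "h n \<in> {1..m} \<and> d (f (h n) (q n)) (q (Suc n)) < \<epsilon>" for n
      using L(5)[of "n mod L"] L(1-3) by (auto simp: q_def h_def mod_Suc)
    \<comment> \<open>Half of \<open>\<eta>\<close> pays for shadowing over \<open>T\<close> steps,
      the other half for attraction of the true orbit.\<close>
    have block: "\<exists>g\<in>G. d g (q (n + T)) < \<eta>" if qU: "q n \<in> U" for n
    proof -
      define w where "w = map (\<lambda>j. h (n + j)) [0..<T]"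
      have w: "w \<in> ifs_words m" "length w = T"
        using qs by (auto simp: w_def ifs_words_def)
      have "d (ifs_comp f w (q n)) (q (n + T)) < \<eta> / 2"
        using \<epsilon>(2)[of "\<lambda>j. q (n + j)" "\<lambda>j. h (n + j)"] qU qM qs by (simp add: w_def)
      moreover obtain g where g: "g \<in> G" "d (ifs_comp f w (q n)) g < \<eta> / 2"
        using attT[OF w(1) w(2)[symmetric] qU] by blast
      moreover have "d g (q (n + T)) \<le> d (ifs_comp f w (q n)) g + d (ifs_comp f w (q n)) (q (n + T))"
        using g(1) GM qM w comp_in triangle commute by (metis subsetD)
      ultimately show ?thesis by force
    qed
    have inU: "q (k * T) \<in> U" for k
    proof (induction k)
      case 0
      show ?case using W L(1,2) by (auto simp: q_def)
    next
      case (Suc k)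
      then obtain g where "g \<in> G" "d g (q (k * T + T)) < \<eta>"
        using block by blast
      then have "q (k * T + T) \<in> mball g \<eta>\<^sub>0"
        using GM qM \<eta> by auto
      with \<open>g \<in> G\<close> have "q (k * T + T) \<in> U"
        using \<eta>\<^sub>0(2) by blast
      then show ?case
        by (simp add: add.commute)
    qed
    \<comment> \<open>The last of \<open>L\<close> blocks ends at time \<open>L * T\<close>, a
      multiple of the period, where the loop is back at \<open>x\<close>.\<close>
    have "(L - 1) * T + T = L * T"
      using L(1) by (cases L) auto
    then have "q ((L - 1) * T + T) = x"
      using L(2) by (simp add: q_def)
    with block[OF inU[of "L - 1"]] \<eta> show ?thesis
      by force
  qed
  have "closedin mtopology G"
    using G compactin_imp_closedin Hausdorff_space_mtopology by blast
  moreover have "x \<in> mtopology closure_of G"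
    unfolding metric_closure_of using near xM GM by (fastforce simp: commute)
  ultimately show ?thesis
    by (simp add: closure_of_closedin)
qed

subsection \<open>Orbitwise chain nodes are compact and forward invariant\<close>

lemma orbitwise_chain_node_eq:
  assumes "N \<in> orbitwise_chain_nodes M d m f"
  obtains x where "x \<in> N"
    "N = {y \<in> orbitwise_chain_recurrent_set M d m f. chain_equiv M d m f x y}"
proof -
  let ?S = "orbitwise_chain_recurrent_set M d m f"
  obtain x where "x \<in> ?S" "N = chain_equiv_rel M d m f ?S `` {x}"
    using assms by (auto simp: orbitwise_chain_nodes_def elim: quotientE)
  then have "N = {y \<in> ?S. chain_equiv M d m f x y}" "x \<in> N"
    by (auto simp: chain_equiv_rel_def chain_equiv_def orbitwise_chain_recurrent_set_def
        intro: chain_ge_refl)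
  then show thesis using that by blast
qed

lemma orbitwise_chain_node_subset: "N \<in> orbitwise_chain_nodes M d m f \<Longrightarrow> N \<subseteq> M"
  by (erule orbitwise_chain_node_eq) (auto simp: orbitwise_chain_recurrent_set_def)

lemma chain_equiv_trans:
  "chain_equiv M d m f x y \<Longrightarrow> chain_equiv M d m f y z \<Longrightarrow> chain_equiv M d m f x z"
  unfolding chain_equiv_def using chain_ge_trans by blast

lemma chain_equiv_sym: "chain_equiv M d m f x y \<Longrightarrow> chain_equiv M d m f y x"
  by (simp add: chain_equiv_def)

lemma orbitwise_chain_node_equiv:
  assumes "N \<in> orbitwise_chain_nodes M d m f" "x \<in> N" "y \<in> N"
  shows "chain_equiv M d m f x y"
  using assms by (elim orbitwise_chain_node_eq) (use chain_equiv_trans chain_equiv_sym in blast)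

text \<open>The point \<open>y\<close> is equivalent to its images under \<open>w\<close> and under
  \<open>w @ v\<close>, so these two are equivalent to each other. Hence the image under
  \<open>w\<close> is again orbitwise chain-recurrent, in the class of \<open>y\<close>.\<close>

lemma orbitwise_chain_node_comp_in:
  assumes N: "N \<in> orbitwise_chain_nodes M d m f" and "y \<in> N" "w \<in> ifs_words m"
  shows "ifs_comp f w y \<in> N"
proof -
  obtain x where x: "N = {y \<in> orbitwise_chain_recurrent_set M d m f. chain_equiv M d m f x y}"
    using N by (rule orbitwise_chain_node_eq)
  have y: "y \<in> M" "chain_equiv M d m f x y"
    "\<And>v. v \<in> ifs_words m \<Longrightarrow> chain_equiv M d m f y (ifs_comp f v y)"
    using assms(2) x by (auto simp: orbitwise_chain_recurrent_set_def ifs_orbit_def)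
  have "chain_equiv M d m f (ifs_comp f w y) (ifs_comp f v (ifs_comp f w y))"
    if "v \<in> ifs_words m" for v
    using y(3)[of w] y(3)[of "w @ v"] assms(3) that chain_equiv_trans chain_equiv_sym
    by (metis ifs_comp_append ifs_words_append)
  then have "ifs_comp f w y \<in> orbitwise_chain_recurrent_set M d m f"
    using y(1) comp_in assms(3) by (auto simp: orbitwise_chain_recurrent_set_def ifs_orbit_def)
  then show ?thesis
    using x y assms(3) chain_equiv_trans by blast
qed

lemma hutchinson_orbitwise_chain_node:
  assumes "N \<in> orbitwise_chain_nodes M d m f"
  shows "hutchinson m f N \<subseteq> N"
  using orbitwise_chain_node_comp_in[OF assms, of _ "[_]"] by (auto simp: hutchinson_def)

text \<open>Makes the results on loops and perturbed ends available for points of a node.\<close>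

lemma orbitwise_chain_node_recurrent:
  assumes "N \<in> orbitwise_chain_nodes M d m f" "x \<in> N"
  shows "x \<in> chain_recurrent_set M d m f"
proof -
  have "f 1 x \<in> N"
    using hutchinson_orbitwise_chain_node[OF assms(1)] assms(2) one_generator
    unfolding hutchinson_def by blast
  then show ?thesis
    using orbitwise_chain_node_equiv[OF assms] orbitwise_chain_node_subset[OF assms(1)] assms(2)
      one_generator unfolding chain_recurrent_set_def by blast
qed

text \<open>The two directions differ. A chain into \<open>z\<close> ends at a nearby
  \<open>y\<close> in \<open>N\<close> and has its end perturbed. A chain out of \<open>z\<close>
  first jumps to \<open>f 1 y\<close>, which continuity of \<open>f 1\<close> at \<open>z\<close>
  permits.\<close>

lemma orbitwise_chain_node_equiv_closure:
  assumes N: "N \<in> orbitwise_chain_nodes M d m f" and x: "x \<in> N"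
    and z: "z \<in> mtopology closure_of N"
  shows "chain_equiv M d m f x z"
proof -
  have zM: "z \<in> M"
    using z by (simp add: metric_closure_of)
  have near: "\<exists>y\<in>N. d z y < r" if "0 < r" for r
    using z that by (fastforce simp: metric_closure_of)
  have "eps_chain M d m f \<epsilon> x z" if \<epsilon>: "0 < \<epsilon>" for \<epsilon>
  proof -
    obtain y where y: "y \<in> N" "d z y < \<epsilon>"
      using near[OF \<epsilon>] by blast
    have "eps_chain M d m f \<epsilon> x y"
      using orbitwise_chain_node_equiv[OF N x y(1)] \<epsilon> by (auto simp: chain_equiv_def chain_ge_def)
    moreover have "eps_chain M d m f \<epsilon> y z"
      using orbitwise_chain_node_recurrent[OF N y(1)] zM y(2)
      by (intro eps_chain_perturb_end) (auto simp: commute)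
    ultimately show ?thesis by (rule eps_chain_trans)
  qed
  moreover have "eps_chain M d m f \<epsilon> z x" if \<epsilon>: "0 < \<epsilon>" for \<epsilon>
  proof -
    obtain \<delta> where \<delta>: "0 < \<delta>" "\<And>b. b \<in> M \<Longrightarrow> d z b < \<delta> \<Longrightarrow> d (f 1 z) (f 1 b) < \<epsilon>"
      using uniformly_continuous_at_compact[OF _ continuous_generator[OF one_generator] \<epsilon>, of "{z}"]
        zM by (metis compactin_sing singletonI topspace_mtopology)
    obtain y where y: "y \<in> N" "d z y < \<delta>"
      using near[OF \<delta>(1)] by blast
    have f1y: "f 1 y \<in> N"
      using hutchinson_orbitwise_chain_node[OF N] y(1) one_generator
      unfolding hutchinson_def by blast
    have NM: "N \<subseteq> M"
      using orbitwise_chain_node_subset[OF N] .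
    have "eps_chain M d m f \<epsilon> z (f 1 y)"
      using \<delta>(2) y NM f1y zM one_generator by (intro eps_chain_step[of _ _ 1]) auto
    moreover have "eps_chain M d m f \<epsilon> (f 1 y) x"
      using orbitwise_chain_node_equiv[OF N f1y x] \<epsilon> by (auto simp: chain_equiv_def chain_ge_def)
    ultimately show ?thesis by (rule eps_chain_trans)
  qed
  ultimately show ?thesis
    by (simp add: chain_equiv_def chain_ge_def)
qed

text \<open>By continuity the whole orbit of a closure point \<open>z\<close> lies in the closure of
  \<open>N\<close>, so every orbit point is equivalent to the same \<open>x\<close>. The empty word
  gives \<open>z\<close> itself.\<close>

lemma closedin_orbitwise_chain_node:
  assumes N: "N \<in> orbitwise_chain_nodes M d m f"
  shows "closedin mtopology N"
proof -
  obtain x where x: "x \<in> N"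
    "N = {y \<in> orbitwise_chain_recurrent_set M d m f. chain_equiv M d m f x y}"
    using N by (rule orbitwise_chain_node_eq)
  have "z \<in> N" if z: "z \<in> mtopology closure_of N" for z
  proof -
    have "chain_equiv M d m f x (ifs_comp f w z)" if w: "w \<in> ifs_words m" for w
    proof (rule orbitwise_chain_node_equiv_closure[OF N x(1)])
      have "ifs_comp f w z \<in> mtopology closure_of (ifs_comp f w ` N)"
        using continuous_map_image_closure_subset[OF continuous_comp[OF w]] z by blast
      also have "\<dots> \<subseteq> mtopology closure_of N"
        using orbitwise_chain_node_comp_in[OF N _ w] by (intro closure_of_mono) auto
      finally show "ifs_comp f w z \<in> mtopology closure_of N" .
    qed
    then have "\<And>w. w \<in> ifs_words m \<Longrightarrow> chain_equiv M d m f z (ifs_comp f w z)"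
      "chain_equiv M d m f x z"
      using chain_equiv_trans chain_equiv_sym by (metis ifs_comp_Nil ifs_words_Nil)+
    moreover have "z \<in> M"
      using z by (simp add: metric_closure_of)
    ultimately show ?thesis
      unfolding x(2) by (auto simp: orbitwise_chain_recurrent_set_def ifs_orbit_def)
  qed
  then show ?thesis
    using orbitwise_chain_node_subset[OF N] by (auto simp: closure_of_subset_eq[symmetric])
qed

lemma compactin_orbitwise_chain_node:
  assumes "locally_compact_space mtopology" "compact_dynamics mtopology d m f"
    and N: "N \<in> orbitwise_chain_nodes M d m f"
  shows "compactin mtopology N"
proof -
  obtain G where G: "global_attractor mtopology d m f G"
    using assms(2) by (auto simp: compact_dynamics_def)
  show ?thesis
  proof (rule closed_compactin)
    show "compactin mtopology G"
      using G by (simp add: global_attractor_def)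
    show "N \<subseteq> G"
      using chain_recurrent_in_attractor[OF assms(1) G] orbitwise_chain_node_recurrent[OF N] by blast
  qed (rule closedin_orbitwise_chain_node[OF N])
qed

subsection \<open>Chains of the Hutchinson map\<close>

lemma hausdorff_dist_less_imp_near:
  assumes "A \<in> hyperspace mtopology" "B \<in> hyperspace mtopology" "hausdorff_dist d A B < \<epsilon>" "b \<in> B"
  obtains a where "a \<in> A" "d a b < \<epsilon>"
proof -
  have A: "A \<noteq> {}" "compactin mtopology A" "A \<subseteq> M" and B: "compactin mtopology B" "B \<subseteq> M"
    using assms(1,2) compactin_subset_topspace by (fastforce simp: hyperspace_def)+
  obtain a0 where a0: "a0 \<in> A" using A by blast
  \<comment> \<open>A common bound for all distances makes the real-valued supremum in
    \<open>hausdorff_dist\<close> a genuine upper bound.\<close>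
  obtain c where c: "\<And>x y. x \<in> A \<union> B \<Longrightarrow> y \<in> A \<union> B \<Longrightarrow> d x y \<le> c"
    using compactin_imp_mbounded[OF compactin_Un[OF A(2) B(1)]] unfolding mbounded_alt by blast
  have "point_set_dist d x A \<le> c" if "x \<in> B" for x
  proof -
    have "point_set_dist d x A \<le> d x a0"
      unfolding point_set_dist_def
      by (rule cINF_lower[OF bdd_belowI2[of _ 0] a0]) simp
    also have "\<dots> \<le> c" using c a0 that by blast
    finally show ?thesis .
  qed
  then have "point_set_dist d b A \<le> (SUP x\<in>B. point_set_dist d x A)"
    using assms(4) by (intro cSUP_upper bdd_aboveI2)
  also have "\<dots> \<le> hausdorff_dist d A B"
    by (simp add: hausdorff_dist_def)
  finally have "(INF a\<in>A. d b a) < \<epsilon>"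
    using assms(3) by (simp add: point_set_dist_def)
  then obtain a where "a \<in> A" "d b a < \<epsilon>"
    using A(1) cInf_lessD[of "d b ` A"] by blast
  then show thesis using that commute by metis
qed

lemma hutchinson_in_hyperspace:
  "A \<in> hyperspace mtopology \<Longrightarrow> hutchinson m f A \<in> hyperspace mtopology"
  using compactin_hutchinson hutchinson_nonempty by (auto simp: hyperspace_def)

text \<open>Each point of \<open>P (Suc n)\<close> is within \<open>\<epsilon>\<close> of some
  \<open>f i x\<close> with \<open>x\<close> in \<open>P n\<close>, which is one step of a chain in
  \<open>M\<close>. Since points are chosen backwards, the start \<open>a\<close> depends on
  \<open>b\<close> and \<open>\<epsilon>\<close>.\<close>

lemma eps_chain_hutchinson_imp:
  assumes "eps_chain (hyperspace mtopology) (hausdorff_dist d) 1 (\<lambda>_. hutchinson m f) \<epsilon> A B"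
    and "b \<in> B"
  obtains a where "a \<in> A" "eps_chain M d m f \<epsilon> a b"
proof -
  obtain k P where P: "P 0 = A" "P k = B" "\<And>n. n \<le> k \<Longrightarrow> P n \<in> hyperspace mtopology"
    "\<And>n. n < k \<Longrightarrow> hausdorff_dist d (hutchinson m f (P n)) (P (Suc n)) < \<epsilon>"
    using assms(1) unfolding eps_chain_def by blast
  have sub: "P n \<subseteq> M" if "n \<le> k" for n
    using P(3)[OF that] compactin_subset_topspace by (fastforce simp: hyperspace_def)
  have "\<exists>a\<in>A. eps_chain M d m f \<epsilon> a y" if "n \<le> k" "y \<in> P n" for n y
    using that
  proof (induction n arbitrary: y)
    case 0
    then have "y \<in> A" "y \<in> M"
      using P(1) sub by auto
    then show ?case by (intro bexI[of _ y] eps_chain_refl)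
  next
    case (Suc n)
    have "n \<le> k" "n < k" using Suc.prems by auto
    obtain z where "z \<in> hutchinson m f (P n)" "d z y < \<epsilon>"
      using hausdorff_dist_less_imp_near hutchinson_in_hyperspace P(3) P(4)[OF \<open>n < k\<close>]
        Suc.prems \<open>n \<le> k\<close> by metis
    then obtain i x where x: "i \<in> {1..m}" "x \<in> P n" "d (f i x) y < \<epsilon>"
      by (auto simp: hutchinson_def)
    then have "eps_chain M d m f \<epsilon> x y"
      using sub[OF \<open>n \<le> k\<close>] sub[OF Suc.prems(1)] Suc.prems(2) by (intro eps_chain_step) auto
    moreover obtain a where "a \<in> A" "eps_chain M d m f \<epsilon> a x"
      using Suc.IH[OF \<open>n \<le> k\<close> x(2)] by blast
    ultimately show ?case using eps_chain_trans by metis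
  qed
  with P(2) assms(2) show thesis using that by blast
qed

text \<open>The traced start \<open>a\<close> varies with \<open>\<epsilon>\<close>, but it stays in
  the node \<open>N\<close>, where the fixed point \<open>x\<close> can be chained to it.\<close>

lemma chain_ge_of_hutchinson_chain_ge:
  assumes "N \<in> orbitwise_chain_nodes M d m f" "A \<subseteq> N" "x \<in> N" "b \<in> B"
    and "chain_ge (hyperspace mtopology) (hausdorff_dist d) 1 (\<lambda>_. hutchinson m f) A B"
  shows "chain_ge M d m f x b"
  unfolding chain_ge_def
proof (intro allI impI)
  fix \<epsilon> :: real assume \<epsilon>: "0 < \<epsilon>"
  then obtain a where a: "a \<in> A" "eps_chain M d m f \<epsilon> a b"
    using assms(4,5) eps_chain_hutchinson_imp unfolding chain_ge_def by metis
  have "eps_chain M d m f \<epsilon> x a"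
    using orbitwise_chain_node_equiv[OF assms(1,3)] assms(2) a(1) \<epsilon>
    by (auto simp: chain_equiv_def chain_ge_def)
  then show "eps_chain M d m f \<epsilon> x b"
    using a(2) by (rule eps_chain_trans)
qed

lemma orbitwise_chain_nodes_eqI:
  assumes "N1 \<in> orbitwise_chain_nodes M d m f" "N2 \<in> orbitwise_chain_nodes M d m f"
    and "x \<in> N1" "y \<in> N2" "chain_equiv M d m f x y"
  shows "N1 = N2"
proof -
  obtain a b where "a \<in> N1" "b \<in> N2"
    "N1 = {z \<in> orbitwise_chain_recurrent_set M d m f. chain_equiv M d m f a z}"
    "N2 = {z \<in> orbitwise_chain_recurrent_set M d m f. chain_equiv M d m f b z}"
    using assms(1,2) by (metis orbitwise_chain_node_eq)
  moreover have "chain_equiv M d m f a b"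
    using orbitwise_chain_node_equiv assms calculation(1,2) chain_equiv_trans by metis
  ultimately show ?thesis
    using chain_equiv_trans chain_equiv_sym by blast
qed

end

section \<open>Separating the chain nodes of the Hutchinson map\<close>

lemma chain_nodes_equiv:
  assumes "C \<in> chain_nodes M d m f" "x \<in> C" "y \<in> C"
  shows "chain_equiv M d m f x y"
proof -
  let ?S = "chain_recurrent_set M d m f"
  have "equiv ?S (chain_equiv_rel M d m f ?S)"
    by (rule equiv_chain_equiv_rel) (auto simp: chain_recurrent_set_def)
  then have "(x, y) \<in> chain_equiv_rel M d m f ?S"
    using assms quotient_eq_iff unfolding chain_nodes_def by metis
  then show ?thesis
    by (simp add: chain_equiv_rel_def)
qed

text \<open>The trivial chain of length 0 serves in both directions.\<close>

lemma fixed_point_chain_recurrent: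
  assumes "x \<in> M" "i \<in> {1..m}" "f i x = x"
  shows "x \<in> chain_recurrent_set M d m f"
  using assms
  by (auto simp: chain_recurrent_set_def chain_equiv_def chain_ge_def intro!: bexI[of _ i] eps_chain_refl)

theorem proposition6p7:
  fixes X :: "'a topology" and d :: "'a \<Rightarrow> 'a \<Rightarrow> real"
    and m :: nat and f :: "nat \<Rightarrow> 'a \<Rightarrow> 'a" and N1 N2 :: "'a set"
  assumes "metrizable_space X" and "separable_space X" and "locally_compact_space X"
    and "Metric_space (topspace X) d" and "Metric_space.mtopology (topspace X) d = X"
    and "ifs X m f" and "compact_dynamics X d m f"
    and "N1 \<in> orbitwise_chain_nodes (topspace X) d m f"
    and "N2 \<in> orbitwise_chain_nodes (topspace X) d m f"
    and "N1 \<noteq> N2"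
  shows "\<exists>C1 \<in> hutchinson_chain_nodes X d m f. \<exists>C2 \<in> hutchinson_chain_nodes X d m f.
           Omega_limit X m f N1 \<in> C1 \<and> Omega_limit X m f N2 \<in> C2 \<and> C1 \<noteq> C2"
proof -
  \<comment> \<open>Naming the carrier lets \<open>X\<close> be replaced by the
    \<open>mtopology\<close> of the interpreted metric space.\<close>
  define M where "M = topspace X"
  interpret Metric_space M d
    using assms(4) by (simp add: M_def)
  have X: "X = mtopology"
    using assms(5) by (simp add: M_def)
  interpret metric_ifs M d m f
    by unfold_locales (use assms(6) X in simp)
  let ?\<Omega> = "Omega_limit mtopology m f"
  let ?ge = "chain_ge (hyperspace mtopology) (hausdorff_dist d) 1 (\<lambda>_. hutchinson m f)"
  have node: "N1 \<in> orbitwise_chain_nodes M d m f" "N2 \<in> orbitwise_chain_nodes M d m f"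
    using assms(8,9) by (simp_all add: M_def)
  have \<Omega>: "?\<Omega> N \<noteq> {}" "?\<Omega> N \<subseteq> N"
    "?\<Omega> N \<in> chain_recurrent_set (hyperspace mtopology) (hausdorff_dist d) 1 (\<lambda>_. hutchinson m f)"
    if N: "N \<in> orbitwise_chain_nodes M d m f" for N
  proof -
    have K: "compactin mtopology N" "hutchinson m f N \<subseteq> N"
      using compactin_orbitwise_chain_node N assms(3,7) X hutchinson_orbitwise_chain_node by auto
    have "N \<noteq> {}"
      using N by (metis empty_iff orbitwise_chain_node_eq)
    then show ne: "?\<Omega> N \<noteq> {}" and "?\<Omega> N \<subseteq> N"
      using Omega_limit_nonempty Omega_limit_subset K by auto
    show "?\<Omega> N \<in> chain_recurrent_set (hyperspace mtopology) (hausdorff_dist d) 1 (\<lambda>_. hutchinson m f)"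
      using ne compactin_Omega_limit[OF K] hutchinson_Omega_limit[OF K]
      by (intro fixed_point_chain_recurrent[of _ _ 1]) (auto simp: hyperspace_def)
  qed
  obtain C1 C2 where C: "C1 \<in> hutchinson_chain_nodes mtopology d m f" "?\<Omega> N1 \<in> C1"
    "C2 \<in> hutchinson_chain_nodes mtopology d m f" "?\<Omega> N2 \<in> C2"
    using ex1_chain_node[OF \<Omega>(3)[OF node(1)]] ex1_chain_node[OF \<Omega>(3)[OF node(2)]]
    unfolding hutchinson_chain_nodes_def by blast
  have "C1 \<noteq> C2"
  proof
    assume "C1 = C2"
    then have ge: "?ge (?\<Omega> N1) (?\<Omega> N2)" "?ge (?\<Omega> N2) (?\<Omega> N1)"
      using C chain_nodes_equiv unfolding hutchinson_chain_nodes_def chain_equiv_def by metis+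
    obtain x y where xy: "x \<in> ?\<Omega> N1" "y \<in> ?\<Omega> N2"
      using \<Omega>(1) node by blast
    then have in_N: "x \<in> N1" "y \<in> N2"
      using \<Omega>(2) node by auto
    \<comment> \<open>Each direction between the omega limits yields the same direction between
      \<open>x\<close> and \<open>y\<close>, because each omega limit lies in its own node.\<close>
    have "chain_equiv M d m f x y"
      unfolding chain_equiv_def
      using chain_ge_of_hutchinson_chain_ge[OF node(1) \<Omega>(2)[OF node(1)] in_N(1) xy(2) ge(1)]
        chain_ge_of_hutchinson_chain_ge[OF node(2) \<Omega>(2)[OF node(2)] in_N(2) xy(1) ge(2)]
      by blast
    with node in_N assms(10) show False
      using orbitwise_chain_nodes_eqI by blast
  qed
  with C show ?thesis
    unfolding X by blast
qed

end
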